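(* Let $m,n,r$ be positive integers with $r\le m$. Then $\mathrm{Occ}(m,n,r)$ is less than or equal to the largest integer $p$ for which there exist nonnegative integers $x_1,x_2,\dots,x_{n^{m-r}}$ satisfying \[ p=\sum_{i=1}^{n^{m-r}} i\,x_i,\qquad \sum_{i=1}^{n^{m-r}} x_i\le n^r,\qquad p\le \binom{m}{r}x_1 . \]
   Context: Let $(A,\le)$ be a partially ordered set of functions on a set $X$. For $S\subseteq X$ and $f\in A$, $f$ is called Occam on $S$ (and $S$ Occam for $f$) if $f$ is the least element of $\{g\in A \mid g|_S=f|_S\}$. The radius $R(f)$ of $f\in A$ is $\min\{|S| : S\subseteq X,\ S \text{ is Occam for } f\}$ if this is finite, and $\infty$ otherwise. When the partial order is equality, $f$ is Occam on $S$ exactly when $f$ is the only function in $A$ that agrees with $f$ on $S$. For positive integers $m,n,r$, $\mathrm{Occ}(m,n,r)$ denotes the maximum possible value of $|A|$, where $|X|=m$, $|Y|=n$, and $A$ is a set of functions from $X$ to $Y$, ordered by equality, such that $R(f)\le r$ for every $f\in A$. *)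

theory Defs
  imports "HOL-Library.FuncSet" "HOL-Library.Extended_Nat"
begin

definition occam_on ::
  "(('a \<Rightarrow> 'b) \<Rightarrow> ('a \<Rightarrow> 'b) \<Rightarrow> bool) \<Rightarrow> ('a \<Rightarrow> 'b) set \<Rightarrow> 'a set \<Rightarrow> ('a \<Rightarrow> 'b) \<Rightarrow> bool"
  where "occam_on le A S f \<longleftrightarrow>
    f \<in> {g \<in> A. restrict g S = restrict f S} \<and>
    (\<forall>h \<in> {g \<in> A. restrict g S = restrict f S}. le f h)"

(* In enat an infimum of a nonempty set is attained, and the infimum of the empty set is \<infinity>. *)
definition radius ::
  "(('a \<Rightarrow> 'b) \<Rightarrow> ('a \<Rightarrow> 'b) \<Rightarrow> bool) \<Rightarrow> 'a set \<Rightarrow> ('a \<Rightarrow> 'b) set \<Rightarrow> ('a \<Rightarrow> 'b) \<Rightarrow> enat"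
  where "radius le X A f =
    (INF S \<in> {S. S \<subseteq> X \<and> finite S \<and> occam_on le A S f}. enat (card S))"

(* X and Y range over finite sets of naturals; this loses no generality, since only their
   cardinalities matter. *)
definition Occ_sizes :: "nat \<Rightarrow> nat \<Rightarrow> nat \<Rightarrow> nat set"
  where "Occ_sizes m n r =
    {card A | (X :: nat set) (Y :: nat set) A.
       finite X \<and> card X = m \<and> finite Y \<and> card Y = n \<and>
       A \<subseteq> X \<rightarrow>\<^sub>E Y \<and> (\<forall>f \<in> A. radius (=) X A f \<le> enat r)}"

definition Occ :: "nat \<Rightarrow> nat \<Rightarrow> nat \<Rightarrow> nat"
  where "Occ m n r = Max (Occ_sizes m n r)"

lemma occam_on_eq_iff:
  "occam_on (=) A S f \<longleftrightarrow> f \<in> A \<and> (\<forall>g \<in> A. restrict g S = restrict f S \<longrightarrow> g = f)"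
  unfolding occam_on_def by auto

lemma radius_le_iff:
  "radius le X A f \<le> enat k \<longleftrightarrow>
    (\<exists>S \<subseteq> X. finite S \<and> card S \<le> k \<and> occam_on le A S f)"
proof
  let ?T = "{S. S \<subseteq> X \<and> finite S \<and> occam_on le A S f}"
  let ?C = "(\<lambda>S. enat (card S)) ` ?T"
  assume h: "radius le X A f \<le> enat k"
  have "?C \<noteq> {}"
  proof
    assume "?C = {}"
    then have "radius le X A f = \<infinity>" unfolding radius_def by (simp only: Inf_enat_def simp_thms if_True)
    with h show False by simp
  qed
  then obtain c where c: "c \<in> ?C" by blast
  have "radius le X A f = (LEAST c. c \<in> ?C)"
    unfolding radius_def by (simp only: Inf_enat_def \<open>?C \<noteq> {}\<close> if_False)
  also have "\<dots> \<in> ?C" using c by (rule LeastI)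
  finally obtain S where "S \<in> ?T" "radius le X A f = enat (card S)" by blast
  with h show "\<exists>S \<subseteq> X. finite S \<and> card S \<le> k \<and> occam_on le A S f"
    by auto
next
  assume "\<exists>S \<subseteq> X. finite S \<and> card S \<le> k \<and> occam_on le A S f"
  then obtain S where S: "S \<subseteq> X" "finite S" "card S \<le> k" "occam_on le A S f" by blast
  then have "radius le X A f \<le> enat (card S)"
    unfolding radius_def by (intro INF_lower) blast
  also have "\<dots> \<le> enat k" using S by simp
  finally show "radius le X A f \<le> enat k" .
qed

lemma finite_Occ_sizes: "finite (Occ_sizes m n r)"
proof (rule finite_subset)
  show "Occ_sizes m n r \<subseteq> {..n ^ m}"
  proof
    fix k assume "k \<in> Occ_sizes m n r"
    then obtain X Y :: "nat set" and A where A: "k = card A" "finite X" "card X = m"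
        "finite Y" "card Y = n" "A \<subseteq> X \<rightarrow>\<^sub>E Y"
      unfolding Occ_sizes_def by blast
    have "card A \<le> card (X \<rightarrow>\<^sub>E Y)"
      using A by (intro card_mono finite_PiE) auto
    then show "k \<in> {..n ^ m}" using A by (simp add: card_PiE)
  qed
qed simp

lemma Occ_sizes_nonempty: "Occ_sizes m n r \<noteq> {}"
proof -
  have "card ({} :: (nat \<Rightarrow> nat) set) \<in> Occ_sizes m n r"
    unfolding Occ_sizes_def
    by (intro CollectI exI[of _ "{..<m}"] exI[of _ "{..<n}"] exI[of _ "{} :: (nat \<Rightarrow> nat) set"]) auto
  then show ?thesis by auto
qed

(* The set of admissible p in the upper bound on Occ is finite and nonempty,
   so its Max is the largest element. *)
lemma
  fixes N K C :: nat
  defines "P \<equiv> {p. \<exists>x :: nat \<Rightarrow> nat. p = (\<Sum>i=1..N. i * x i) \<and> (\<Sum>i=1..N. x i) \<le> K \<and> p \<le> C * x 1}"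
  shows finite_admissible: "finite P" and admissible_nonempty: "P \<noteq> {}"
proof -
  have "(\<Sum>i=1..N. i * x i) \<le> N * K" if "(\<Sum>i=1..N. x i) \<le> K" for x :: "nat \<Rightarrow> nat"
  proof -
    have "(\<Sum>i=1..N. i * x i) \<le> (\<Sum>i=1..N. N * x i)" by (intro sum_mono) auto
    also have "\<dots> = N * (\<Sum>i=1..N. x i)" by (simp add: sum_distrib_left)
    finally show ?thesis using mult_le_mono2[OF that, of N] by linarith
  qed
  then have "P \<subseteq> {..N * K}" unfolding P_def by blast
  then show "finite P" by (rule finite_subset) simp
  have "0 \<in> P" unfolding P_def by (intro CollectI exI[of _ "\<lambda>_. 0"]) simp
  then show "P \<noteq> {}" by auto
qed

end

theory Submission
  imports Defs
begin

text \<open>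
  Every \<open>f \<in> A\<close> is Occam on some \<open>r\<close>-subset of \<open>X\<close>, so by averaging there is one \<open>r\<close>-subset \<open>S\<close>
  on which at least a fraction \<open>1 / (m choose r)\<close> of \<open>A\<close> is Occam. Partition \<open>A\<close> by restriction
  to \<open>S\<close> and let \<open>x i\<close> be the number of classes of size \<open>i\<close>. There are at most \<open>n ^ r\<close> classes, each
  has at most \<open>n ^ (m - r)\<close> elements, and the singleton classes are exactly those of the functions
  that are Occam on \<open>S\<close>. Hence \<open>card A\<close> is itself one of the admissible \<open>p\<close>.
\<close>

text \<open>Agreement on \<open>T\<close> forces agreement on \<open>S\<close>, so enlarging the set
  only removes competitors of \<open>f\<close>. This allows Occam sets of size at most
  \<open>r\<close> to be replaced by ones of size exactly \<open>r\<close>.\<close>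

lemma occam_on_eq_mono:
  assumes "occam_on (=) A S f" "S \<subseteq> T"
  shows "occam_on (=) A T f"
proof -
  have "restrict g S = restrict f S" if "restrict g T = restrict f T" for g
  proof (rule ext)
    fix x show "restrict g S x = restrict f S x"
      using fun_cong[OF that, of x] assms(2) by (auto simp: restrict_def split: if_splits)
  qed
  then show ?thesis using assms(1) unfolding occam_on_eq_iff by blast
qed

lemma ex_superset_card:
  assumes "finite X" "S \<subseteq> X" "card S \<le> r" "r \<le> card X"
  shows "\<exists>T. S \<subseteq> T \<and> T \<subseteq> X \<and> card T = r"
proof -
  have fS: "finite S" using assms finite_subset by blast
  then have "r - card S \<le> card (X - S)"
    using assms by (simp add: card_Diff_subset)
  then obtain W where W: "W \<subseteq> X - S" "card W = r - card S"
    using obtain_subset_with_card_n by metis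
  have "finite W" using W assms(1) finite_subset by blast
  then have "card (S \<union> W) = r"
    using W fS assms(3) by (subst card_Un_disjoint) auto
  then show ?thesis using W assms(2) by (intro exI[of _ "S \<union> W"]) auto
qed

text \<open>The averaging step: a largest \<open>U i\<close> has at least the average size, and the
  sizes sum to at least \<open>card A\<close> by the union bound.\<close>

lemma ex_large_cover_member:
  assumes "finite I" "I \<noteq> {}" "\<And>i. i \<in> I \<Longrightarrow> finite (U i)" "A \<subseteq> (\<Union>i\<in>I. U i)"
  shows "\<exists>i\<in>I. card A \<le> card I * card (U i)"
proof -
  have "Max ((\<lambda>i. card (U i)) ` I) \<in> (\<lambda>i. card (U i)) ` I"
    using assms by (intro Max_in) auto
  then obtain i where i: "i \<in> I" "card (U i) = Max ((\<lambda>i. card (U i)) ` I)" by auto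
  have "card A \<le> card (\<Union>i\<in>I. U i)" using assms by (intro card_mono) auto
  also have "\<dots> \<le> (\<Sum>j\<in>I. card (U j))" using assms(1) by (rule card_UN_le)
  also have "\<dots> \<le> card I * card (U i)"
    using sum_bounded_above[of I "\<lambda>j. card (U j)" "card (U i)"] assms(1) i by simp
  finally show ?thesis using i by blast
qed

text \<open>Both identities come from grouping the fibres of \<open>f\<close> by size: one weights
  each fibre by its size, the other by 1.\<close>

lemma card_eq_sum_fibre_sizes:
  assumes "finite A" "\<And>b. b \<in> f ` A \<Longrightarrow> card {a \<in> A. f a = b} \<le> N"
  defines "x \<equiv> \<lambda>i. card {b \<in> f ` A. card {a \<in> A. f a = b} = i}"
  shows "card A = (\<Sum>i=1..N. i * x i)" and "(\<Sum>i=1..N. x i) = card (f ` A)"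
proof -
  define c where "c b = card {a \<in> A. f a = b}" for b
  have "c b > 0" if "b \<in> f ` A" for b
    unfolding c_def using that assms(1) by (subst card_gt_0_iff) auto
  \<comment> \<open>Fibres over points of the image are nonempty, so size 0 never occurs and summing
    from 1 loses no fibre.\<close>
  then have im: "c ` f ` A \<subseteq> {1..N}"
    using assms(2) by (force simp: c_def Suc_le_eq)
  have "card A = (\<Sum>b\<in>f ` A. \<Sum>a | a \<in> A \<and> f a = b. 1)"
    using sum.image_gen[OF assms(1), of "\<lambda>_. 1::nat" f] by simp
  also have "\<dots> = (\<Sum>b\<in>f ` A. c b)" by (simp add: c_def)
  also have "\<dots> = (\<Sum>i=1..N. \<Sum>b | b \<in> f ` A \<and> c b = i. c b)"
    using assms(1) im by (intro sum.group[symmetric]) auto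
  also have "\<dots> = (\<Sum>i=1..N. i * x i)"
    by (intro sum.cong refl) (simp add: x_def c_def)
  finally show "card A = (\<Sum>i=1..N. i * x i)" .
  have "(\<Sum>i=1..N. x i) = (\<Sum>i=1..N. \<Sum>b | b \<in> f ` A \<and> c b = i. 1)"
    by (simp add: x_def c_def)
  also have "\<dots> = card (f ` A)"
    using sum.group[of "f ` A" "{1..N}" c "\<lambda>_. 1::nat"] assms(1) im by simp
  finally show "(\<Sum>i=1..N. x i) = card (f ` A)" .
qed

text \<open>The map \<open>f\<close> itself is a bijection from the elements alone in their fibre to
  the values with a one-element fibre.\<close>

lemma card_singleton_fibres:
  "card {b \<in> f ` A. card {a \<in> A. f a = b} = 1} = card {a \<in> A. \<forall>a'\<in>A. f a' = f a \<longrightarrow> a' = a}"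
    (is "card ?B = card ?U")
proof -
  have inj: "inj_on f ?U" by (auto simp: inj_on_def)
  have "f ` ?U = ?B"
  proof (intro equalityI subsetI)
    fix b assume "b \<in> f ` ?U"
    then obtain a where a: "a \<in> ?U" "b = f a" by blast
    then have "{a' \<in> A. f a' = b} = {a}" by auto
    then show "b \<in> ?B" using a by simp
  next
    fix b assume "b \<in> ?B"
    then obtain a where a: "{a' \<in> A. f a' = b} = {a}" by (auto simp: card_1_singleton_iff)
    have fa: "a \<in> A" "f a = b" using equalityD2[OF a] by simp_all
    have "a' = a" if "a' \<in> A" "f a' = b" for a' using subsetD[OF equalityD1[OF a], of a'] that by simp
    then have "a \<in> ?U" using fa by blast
    then show "b \<in> f ` ?U" using fa(2) by (rule rev_image_eqI[OF _ sym])
  qed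
  then show ?thesis using card_image[OF inj] by (rule subst)
qed

text \<open>Functions in one fibre agree on \<open>S\<close>, so each is determined by its
  restriction to \<open>X - S\<close>.\<close>

lemma card_restrict_fibre_le:
  assumes "finite X" "finite Y" "A \<subseteq> X \<rightarrow>\<^sub>E Y" "S \<subseteq> X"
  shows "card {f \<in> A. restrict f S = g} \<le> card Y ^ (card X - card S)"
proof -
  let ?F = "{f \<in> A. restrict f S = g}"
  have "inj_on (\<lambda>f. restrict f (X - S)) ?F"
  proof (rule inj_onI)
    fix f h assume *: "f \<in> ?F" "h \<in> ?F" "restrict f (X - S) = restrict h (X - S)"
    show "f = h"
    proof (rule PiE_ext)
      show "f \<in> X \<rightarrow>\<^sub>E Y" "h \<in> X \<rightarrow>\<^sub>E Y" using * assms(3) by auto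
      fix x assume x: "x \<in> X"
      have "restrict f S x = restrict h S x" using * by simp
      moreover have "restrict f (X - S) x = restrict h (X - S) x" using * by simp
      ultimately show "f x = h x" using x by (cases "x \<in> S") auto
    qed
  qed
  moreover have "(\<lambda>f. restrict f (X - S)) ` ?F \<subseteq> (X - S) \<rightarrow>\<^sub>E Y"
    by (simp only: image_subset_iff restrict_PiE_iff) (blast dest: PiE_mem[OF subsetD[OF assms(3)]])
  moreover have "finite ((X - S) \<rightarrow>\<^sub>E Y)"
    using assms by (intro finite_PiE) auto
  ultimately have "card ?F \<le> card ((X - S) \<rightarrow>\<^sub>E Y)" by (rule card_inj_on_le)
  also have "\<dots> = card Y ^ (card X - card S)"
    using assms finite_subset[OF assms(4,1)] by (simp add: card_PiE card_Diff_subset)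
  finally show ?thesis .
qed

lemma card_restrict_image_le:
  assumes "finite X" "finite Y" "A \<subseteq> X \<rightarrow>\<^sub>E Y" "S \<subseteq> X"
  shows "card ((\<lambda>f. restrict f S) ` A) \<le> card Y ^ card S"
proof -
  have fS: "finite S" using assms finite_subset by blast
  have "(\<lambda>f. restrict f S) ` A \<subseteq> S \<rightarrow>\<^sub>E Y"
    using assms(4)
    by (simp only: image_subset_iff restrict_PiE_iff) (blast dest: PiE_mem[OF subsetD[OF assms(3)]])
  then have "card ((\<lambda>f. restrict f S) ` A) \<le> card (S \<rightarrow>\<^sub>E Y)"
    using fS assms(2) by (intro card_mono finite_PiE) auto
  then show ?thesis using fS by (simp add: card_PiE)
qed

lemma Occ_sizes_admissible:
  assumes "r \<le> m" "k \<in> Occ_sizes m n r"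
  shows "\<exists>x :: nat \<Rightarrow> nat.
    k = (\<Sum>i = 1..n ^ (m - r). i * x i) \<and>
    (\<Sum>i = 1..n ^ (m - r). x i) \<le> n ^ r \<and>
    k \<le> (m choose r) * x 1"
proof -
  obtain X Y :: "nat set" and A where A: "k = card A" "finite X" "card X = m"
      "finite Y" "card Y = n" "A \<subseteq> X \<rightarrow>\<^sub>E Y"
      and rad: "\<And>f. f \<in> A \<Longrightarrow> radius (=) X A f \<le> enat r"
    using assms(2) unfolding Occ_sizes_def by blast
  have finA: "finite A"
    using A finite_subset[OF A(6)] by (simp add: finite_PiE)
  define I where "I = {S. S \<subseteq> X \<and> card S = r}"
  have finI: "finite I" unfolding I_def using A(2) by simp
  have cardI: "card I = m choose r"
    unfolding I_def using A n_subsets by auto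
  \<comment> \<open>Here \<open>r \<le> m\<close> makes the binomial coefficient positive.\<close>
  then have "I \<noteq> {}" using assms(1) by (auto simp: zero_less_binomial_iff)
  define U where "U S = {f \<in> A. occam_on (=) A S f}" for S
  have "A \<subseteq> (\<Union>S\<in>I. U S)"
  proof
    fix f assume f: "f \<in> A"
    obtain S where S: "S \<subseteq> X" "card S \<le> r" "occam_on (=) A S f"
      using rad[OF f] unfolding radius_le_iff by blast
    \<comment> \<open>The radius bound only gives a set of size at most \<open>r\<close>; it is
      padded to a member of \<open>I\<close>.\<close>
    then obtain T where T: "S \<subseteq> T" "T \<subseteq> X" "card T = r"
      using ex_superset_card[OF A(2)] A(3) assms(1) by blast
    then have "f \<in> U T"
      using f S occam_on_eq_mono unfolding U_def by blast
    then show "f \<in> (\<Union>S\<in>I. U S)" using T by (auto simp: I_def)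
  qed
  then obtain S where S: "S \<in> I" "card A \<le> card I * card (U S)"
    using ex_large_cover_member[OF finI \<open>I \<noteq> {}\<close>, of U A] finA by (auto simp: U_def)
  have SX: "S \<subseteq> X" "card S = r" using S by (auto simp: I_def)
  define x where "x i = card {g \<in> (\<lambda>f. restrict f S) ` A.
    card {f \<in> A. restrict f S = g} = i}" for i
  have bound: "card {f \<in> A. restrict f S = g} \<le> n ^ (m - r)" for g
    using card_restrict_fibre_le[OF A(2,4,6) SX(1)] SX A by simp
  \<comment> \<open>For the order \<open>(=)\<close>, being Occam on \<open>S\<close> means being
    alone in one's class under restriction to \<open>S\<close>.\<close>
  have "x 1 = card (U S)"
    unfolding x_def card_singleton_fibres U_def
    by (rule arg_cong[where f = card]) (auto simp: occam_on_eq_iff)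
  then have "k \<le> (m choose r) * x 1" using S A cardI by simp
  moreover have "k = (\<Sum>i = 1..n ^ (m - r). i * x i)"
    unfolding x_def A(1) by (rule card_eq_sum_fibre_sizes(1)[OF finA bound])
  moreover have "(\<Sum>i = 1..n ^ (m - r). x i) = card ((\<lambda>f. restrict f S) ` A)"
    unfolding x_def by (rule card_eq_sum_fibre_sizes(2)[OF finA bound])
  then have "(\<Sum>i = 1..n ^ (m - r). x i) \<le> n ^ r"
    using card_restrict_image_le[OF A(2,4,6) SX(1)] SX A by simp
  ultimately show ?thesis by blast
qed

theorem theorem1p1:
  fixes m n r :: nat
  assumes "m > 0" and "n > 0" and "r > 0" and "r \<le> m"
  shows "Occ m n r \<le>
    Max {p :: nat. \<exists>x :: nat \<Rightarrow> nat.
      p = (\<Sum>i = 1..n ^ (m - r). i * x i) \<and>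
      (\<Sum>i = 1..n ^ (m - r). x i) \<le> n ^ r \<and>
      p \<le> (m choose r) * x 1}"
proof -
  \<comment> \<open>The maximum is attained, so \<open>Occ m n r\<close> is the size of an actual
    family and is therefore an admissible \<open>p\<close>.\<close>
  have "Occ m n r \<in> Occ_sizes m n r"
    unfolding Occ_def using finite_Occ_sizes Occ_sizes_nonempty by (rule Max_in)
  from Occ_sizes_admissible[OF assms(4) this] show ?thesis
    by (intro Max_ge[OF finite_admissible]) (rule CollectI)
qed

end
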